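(* The Fisher--Rao metric of the two-parameter family of Pareto distributions with densities $p(x\,|\,\alpha,\beta)=\dfrac{\beta\alpha^\beta}{x^{\beta+1}}I_{[x\ge\alpha]}$, $\alpha>0$, $\beta>0$, is given by \[ g=\frac{\beta^2}{\alpha^2}\,\mathrm d\alpha\otimes\mathrm d\alpha+\frac{1}{\beta^2}\,\mathrm d\beta\otimes\mathrm d\beta . \]
   Context: For a family of densities $p(x\,|\,\theta)$ with parameter $\theta=(\theta^1,\dots,\theta^m)$ in an open subset of $\mathbb R^m$, the Fisher--Rao metric is $g=g_{ij}\,\mathrm d\theta^i\otimes\mathrm d\theta^j$ (summation over repeated indices) with \[ g_{ij}(\theta)=E[\partial_i l(X\,|\,\theta)\,\partial_j l(X\,|\,\theta)]=\int \partial_i l(x\,|\,\theta)\,\partial_j l(x\,|\,\theta)\,p(x\,|\,\theta)\,\mathrm dx, \] where $\partial_i=\partial/\partial\theta^i$, $l=\log p$, and $X$ has density $p(\cdot\,|\,\theta)$. Here $(\theta^1,\theta^2)=(\alpha,\beta)$ and the log-likelihood on the support $x\ge\alpha$ is $l(x\,|\,\alpha,\beta)=\log\beta+\beta\log\alpha-(\beta+1)\log x$, whose partial derivatives are taken from this formula. $I_{[\cdot]}$ denotes the indicator function. *)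

theory Defs
  imports "HOL-Analysis.Analysis"
begin

definition partial_deriv :: "'m \<Rightarrow> (real ^ 'm \<Rightarrow> real) \<Rightarrow> real ^ 'm \<Rightarrow> real" where
  "partial_deriv i f \<theta> = deriv (\<lambda>t. f (\<theta> + t *\<^sub>R axis i 1)) 0"

definition has_partial_deriv :: "'m \<Rightarrow> (real ^ 'm \<Rightarrow> real) \<Rightarrow> real ^ 'm \<Rightarrow> bool" where
  "has_partial_deriv i f \<theta> \<longleftrightarrow> (\<lambda>t. f (\<theta> + t *\<^sub>R axis i 1)) field_differentiable (at 0)"

text \<open>Tangent spaces of an open subset of \<open>\<real>\<^sup>m\<close> are identified with \<open>\<real>\<^sup>m\<close>, so
  \<open>coord_form i\<close> is the coordinate one-form \<open>d\<theta>\<^sup>i\<close>, and a covariant 2-tensor at a point is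
  a function of two tangent vectors.\<close>

definition coord_form :: "'m \<Rightarrow> real ^ 'm \<Rightarrow> real" where
  "coord_form i u = u $ i"

definition form_tensor :: "('v \<Rightarrow> real) \<Rightarrow> ('v \<Rightarrow> real) \<Rightarrow> 'v \<Rightarrow> 'v \<Rightarrow> real"
    (infixl "\<otimes>\<^sub>f" 75) where
  "(\<omega> \<otimes>\<^sub>f \<eta>) u v = \<omega> u * \<eta> v"

text \<open>The log-likelihood \<open>l\<close> is passed separately from the density \<open>p\<close>: it should equal
  \<open>ln (p \<theta> x)\<close> on the support and be given by an expression that can be differentiated in
  \<open>\<theta>\<close> at fixed \<open>x\<close>, also at points \<open>x\<close> where the support depends on \<open>\<theta>\<close>. Off the support its
  values are irrelevant, since the integrand carries the factor \<open>p \<theta> x\<close>.\<close>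

definition fisher_integrand ::
  "(real ^ 'm \<Rightarrow> 'x \<Rightarrow> real) \<Rightarrow> (real ^ 'm \<Rightarrow> 'x \<Rightarrow> real) \<Rightarrow> real ^ 'm \<Rightarrow> 'm \<Rightarrow> 'm \<Rightarrow> 'x \<Rightarrow> real" where
  "fisher_integrand p l \<theta> i j x =
     partial_deriv i (\<lambda>\<theta>. l \<theta> x) \<theta> * partial_deriv j (\<lambda>\<theta>. l \<theta> x) \<theta> * p \<theta> x"

definition fisher_matrix ::
  "(real ^ 'm \<Rightarrow> 'x::euclidean_space \<Rightarrow> real) \<Rightarrow> (real ^ 'm \<Rightarrow> 'x \<Rightarrow> real) \<Rightarrow> real ^ 'm \<Rightarrow> 'm \<Rightarrow> 'm \<Rightarrow> real" where
  "fisher_matrix p l \<theta> i j = (\<integral>x. fisher_integrand p l \<theta> i j x \<partial>lborel)"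

definition fisher_rao_metric ::
  "(real ^ 'm::finite \<Rightarrow> 'x::euclidean_space \<Rightarrow> real) \<Rightarrow> (real ^ 'm \<Rightarrow> 'x \<Rightarrow> real)
    \<Rightarrow> real ^ 'm \<Rightarrow> real ^ 'm \<Rightarrow> real ^ 'm \<Rightarrow> real" where
  "fisher_rao_metric p l \<theta> u v =
     (\<Sum>i\<in>UNIV. \<Sum>j\<in>UNIV. fisher_matrix p l \<theta> i j * (coord_form i \<otimes>\<^sub>f coord_form j) u v)"

text \<open>Both \<open>deriv\<close> and the Bochner integral are total, so that the quantities above really
  exist has to be said separately.\<close>

definition fisher_rao_well_defined ::
  "(real ^ 'm::finite \<Rightarrow> 'x::euclidean_space \<Rightarrow> real) \<Rightarrow> (real ^ 'm \<Rightarrow> 'x \<Rightarrow> real) \<Rightarrow> real ^ 'm \<Rightarrow> bool" where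
  "fisher_rao_well_defined p l \<theta> \<longleftrightarrow>
     (\<forall>x i. p \<theta> x > 0 \<longrightarrow> has_partial_deriv i (\<lambda>\<theta>. l \<theta> x) \<theta>) \<and>
     (\<forall>i j. integrable lborel (fisher_integrand p l \<theta> i j))"

definition pareto_density :: "real ^ 2 \<Rightarrow> real \<Rightarrow> real" where
  "pareto_density \<theta> x =
     (let \<alpha> = \<theta> $ 1; \<beta> = \<theta> $ 2
      in \<beta> * \<alpha> powr \<beta> / x powr (\<beta> + 1) * indicator {\<alpha>..} x)"

definition pareto_loglik :: "real ^ 2 \<Rightarrow> real \<Rightarrow> real" where
  "pareto_loglik \<theta> x =
     (let \<alpha> = \<theta> $ 1; \<beta> = \<theta> $ 2
      in ln \<beta> + \<beta> * ln \<alpha> - (\<beta> + 1) * ln x)"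

lemma pareto_loglik_eq_ln_density:
  assumes "\<theta> $ 1 > 0" "\<theta> $ 2 > 0" "x \<ge> \<theta> $ 1"
  shows "pareto_loglik \<theta> x = ln (pareto_density \<theta> x)"
  using assms by (simp add: pareto_loglik_def pareto_density_def Let_def ln_mult ln_div ln_powr)

end

theory Submission
  imports Defs "HOL-Real_Asymp.Real_Asymp"
begin

text \<open>Under the Pareto distribution \<open>ln (X / \<alpha>)\<close> is exponential with rate \<open>\<beta>\<close>, so its first two
  moments are \<open>1 / \<beta>\<close> and \<open>2 / \<beta>\<^sup>2\<close>. The score is \<open>(\<beta> / \<alpha>, 1 / \<beta> - ln (X / \<alpha>))\<close>, whose first
  component is constant and whose second one is centred with variance \<open>1 / \<beta>\<^sup>2\<close>.\<close>

lemma pareto_loglik_has_derivative_1: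
  assumes "\<alpha> > 0"
  shows "((\<lambda>t. pareto_loglik (vector [\<alpha>, \<beta>] + t *\<^sub>R axis 1 1) x) has_field_derivative \<beta> / \<alpha>) (at 0)"
  unfolding pareto_loglik_def Let_def using assms
  by (auto intro!: derivative_eq_intros simp: axis_def field_simps)

text \<open>The logarithms of \<alpha> and \<open>x\<close> stay separate, since \<open>x\<close> is
  arbitrary here; they are merged into \<open>ln (x / \<alpha>)\<close> later, once
  \<open>x > 0\<close> is known.\<close>

lemma pareto_loglik_has_derivative_2:
  assumes "\<beta> > 0"
  shows "((\<lambda>t. pareto_loglik (vector [\<alpha>, \<beta>] + t *\<^sub>R axis 2 1) x) has_field_derivative
    1 / \<beta> + ln \<alpha> - ln x) (at 0)"
  unfolding pareto_loglik_def Let_def using assms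
  by (auto intro!: derivative_eq_intros simp: axis_def field_simps)

text \<open>The coefficients are nonnegative so that the antiderivative yields integrability as well as
  the value; signed combinations follow by linearity.\<close>

lemma pareto_has_bochner_integral_log_quadratic:
  fixes \<alpha> \<beta> a b c :: real
  assumes "\<alpha> > 0" "\<beta> > 0" "a \<ge> 0" "b \<ge> 0" "c \<ge> 0"
  shows "has_bochner_integral lborel
    (\<lambda>x. (a + b * ln (x / \<alpha>) + c * (ln (x / \<alpha>))\<^sup>2) * pareto_density (vector [\<alpha>, \<beta>]) x)
    (a + b / \<beta> + 2 * c / \<beta>\<^sup>2)"
proof -
  define f where "f x = (a + b * ln (x / \<alpha>) + c * (ln (x / \<alpha>))\<^sup>2) *
    (\<beta> * \<alpha> powr \<beta> / x powr (\<beta> + 1))" for x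
  \<comment> \<open>With \<open>y = ln (x / \<alpha>)\<close> and
    \<open>P y = a + b * y + c * y^2\<close>, the integral becomes that of
    \<open>\<beta> * exp (- \<beta> * y) * P y\<close>. An antiderivative
    \<open>- exp (- \<beta> * y) * q y\<close> requires \<open>q - q' / \<beta> = P\<close>, which
    is solved by \<open>q = P + P' / \<beta> + P'' / \<beta>^2\<close>.\<close>
  define F where "F x = - ((x / \<alpha>) powr (- \<beta>) *
    (c * (ln (x / \<alpha>))\<^sup>2 + (b + 2 * c / \<beta>) * ln (x / \<alpha>) + (a + b / \<beta> + 2 * c / \<beta>\<^sup>2)))" for x
  have deriv: "(F has_real_derivative f x) (at x)" if "\<alpha> \<le> x" for x
  proof -
    have "x > 0" using that assms by simp
    \<comment> \<open>The density and the derivative of \<open>F\<close> are both expressed through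
      the power \<open>(x / \<alpha>) powr (- \<beta>)\<close>, so that comparing them is pure field
      arithmetic.\<close>
    have eq: "\<beta> * \<alpha> powr \<beta> / x powr (\<beta> + 1) = \<beta> * (x / \<alpha>) powr (- \<beta>) / x"
      using \<open>x > 0\<close> assms by (simp add: powr_divide powr_minus powr_add field_simps)
    have eq': "(x / \<alpha>) powr (- \<beta> - 1) = (x / \<alpha>) powr (- \<beta>) * \<alpha> / x"
      using \<open>x > 0\<close> assms by (simp add: powr_diff)
    show ?thesis
      unfolding F_def[abs_def] f_def eq
      apply (rule derivative_eq_intros refl | (use \<open>x > 0\<close> assms in simp; fail))+
      using \<open>x > 0\<close> assms by (simp add: eq' powr_minus powr_diff field_simps power2_eq_square)
  qed
  have nonneg: "0 \<le> f x" if "\<alpha> \<le> x" for x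
    using that assms by (simp add: f_def)
  \<comment> \<open>The negative power of \<open>x\<close> beats every power of
    \<open>ln x\<close>.\<close>
  have lim: "(F \<longlongrightarrow> 0) at_top"
    unfolding F_def[abs_def] using assms(1,2) by real_asymp
  have [measurable]: "f \<in> borel_measurable borel"
    unfolding f_def[abs_def] by measurable
  have "(\<integral>\<^sup>+x. ennreal (f x * indicator {\<alpha>..} x) \<partial>lborel) =
      (\<integral>\<^sup>+x. ennreal (f x) * indicator {\<alpha>..} x \<partial>lborel)"
    by (intro nn_integral_cong) (simp split: split_indicator)
  also have "\<dots> = ennreal (0 - F \<alpha>)"
    by (rule nn_integral_FTC_atLeast[OF _ deriv nonneg lim]) auto
  \<comment> \<open>At \<open>x = \<alpha>\<close> the logarithm vanishes and the power is 1, so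
    only the constant term of \<open>q\<close> survives.\<close>
  also have "0 - F \<alpha> = a + b / \<beta> + 2 * c / \<beta>\<^sup>2"
    using assms by (simp add: F_def)
  finally have "has_bochner_integral lborel (\<lambda>x. f x * indicator {\<alpha>..} x)
      (a + b / \<beta> + 2 * c / \<beta>\<^sup>2)"
    using assms nonneg
    by (intro has_bochner_integral_nn_integral) (auto split: split_indicator)
  then show ?thesis
    by (simp add: f_def pareto_density_def Let_def mult.assoc)
qed

lemma pareto_fisher_integrand:
  assumes "\<alpha> > 0" "\<beta> > 0"
  defines "s \<equiv> \<lambda>i x. if i = 1 then \<beta> / \<alpha> else 1 / \<beta> - ln (x / \<alpha>)"
  shows "fisher_integrand pareto_density pareto_loglik (vector [\<alpha>, \<beta>]) i j =
    (\<lambda>x. s i x * s j x * pareto_density (vector [\<alpha>, \<beta>]) x)"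
proof
  fix x
  have 1: "partial_deriv 1 (\<lambda>\<theta>. pareto_loglik \<theta> x) (vector [\<alpha>, \<beta>]) = \<beta> / \<alpha>"
    unfolding partial_deriv_def
    by (rule DERIV_imp_deriv[OF pareto_loglik_has_derivative_1[OF assms(1)]])
  have 2: "partial_deriv 2 (\<lambda>\<theta>. pareto_loglik \<theta> x) (vector [\<alpha>, \<beta>]) = 1 / \<beta> + ln \<alpha> - ln x"
    unfolding partial_deriv_def
    by (rule DERIV_imp_deriv[OF pareto_loglik_has_derivative_2[OF assms(2)]])
  have "partial_deriv k (\<lambda>\<theta>. pareto_loglik \<theta> x) (vector [\<alpha>, \<beta>]) = s k x" if "x > 0" for k
    using that assms exhaust_2[of k] 1 2 by (auto simp: s_def ln_div)
  \<comment> \<open>Splitting \<open>ln (x / \<alpha>)\<close> is justified above only for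
    \<open>x > 0\<close>; elsewhere the vanishing density makes both sides 0.\<close>
  moreover have "pareto_density (vector [\<alpha>, \<beta>]) x = 0" if "x \<le> 0"
    using that assms by (simp add: pareto_density_def)
  ultimately show "fisher_integrand pareto_density pareto_loglik (vector [\<alpha>, \<beta>]) i j x =
      s i x * s j x * pareto_density (vector [\<alpha>, \<beta>]) x"
    unfolding fisher_integrand_def by (cases "x > 0") auto
qed

text \<open>This form delivers integrability, for well-definedness, together with the values of the
  matrix entries.\<close>

lemma pareto_fisher_has_bochner_integral:
  assumes "\<alpha> > 0" "\<beta> > 0"
  shows "has_bochner_integral lborel
    (fisher_integrand pareto_density pareto_loglik (vector [\<alpha>, \<beta>]) i j)
    (if i = j then if i = 1 then \<beta>\<^sup>2 / \<alpha>\<^sup>2 else 1 / \<beta>\<^sup>2 else 0)"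
proof -
  let ?p = "pareto_density (vector [\<alpha>, \<beta>])"
  note moment = pareto_has_bochner_integral_log_quadratic[OF assms]
  \<comment> \<open>The product expands to
    \<open>1 / \<alpha> - (\<beta> / \<alpha>) * ln (x / \<alpha>)\<close>; each of the two parts
    has expectation \<open>1 / \<alpha>\<close>.\<close>
  have cross: "has_bochner_integral lborel
      (\<lambda>x. (\<beta> / \<alpha>) * (1 / \<beta> - ln (x / \<alpha>)) * ?p x) 0"
    using has_bochner_integral_diff[OF moment[of "1 / \<alpha>" 0 0] moment[of 0 "\<beta> / \<alpha>" 0]] assms
    by (simp add: algebra_simps)
  \<comment> \<open>The square is split by sign:
    \<open>1 / \<beta>^2 + (ln (x / \<alpha>))^2\<close> has expectation
    \<open>3 / \<beta>^2\<close>, and the subtracted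
    \<open>(2 / \<beta>) * ln (x / \<alpha>)\<close> has \<open>2 / \<beta>^2\<close>.\<close>
  have square: "has_bochner_integral lborel (\<lambda>x. (1 / \<beta> - ln (x / \<alpha>))\<^sup>2 * ?p x) (1 / \<beta>\<^sup>2)"
    using has_bochner_integral_diff[OF moment[of "1 / \<beta>\<^sup>2" 0 1] moment[of 0 "2 / \<beta>" 0]] assms
    by (simp add: algebra_simps power2_eq_square)
  have const: "has_bochner_integral lborel (\<lambda>x. (\<beta> / \<alpha>)\<^sup>2 * ?p x) (\<beta>\<^sup>2 / \<alpha>\<^sup>2)"
    using moment[of "(\<beta> / \<alpha>)\<^sup>2" 0 0] by (simp add: power_divide)
  show ?thesis
    unfolding pareto_fisher_integrand[OF assms]
    using exhaust_2[of i] exhaust_2[of j] cross square const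
    by (auto simp: power2_eq_square mult.commute)
qed

theorem proposition11:
  fixes \<alpha> \<beta> :: real
  assumes "\<alpha> > 0" and "\<beta> > 0"
  shows "fisher_rao_well_defined pareto_density pareto_loglik (vector [\<alpha>, \<beta>]) \<and>
    fisher_rao_metric pareto_density pareto_loglik (vector [\<alpha>, \<beta>]) =
      (\<lambda>u v. \<beta>\<^sup>2 / \<alpha>\<^sup>2 * (coord_form 1 \<otimes>\<^sub>f coord_form 1) u v
           + 1 / \<beta>\<^sup>2 * (coord_form 2 \<otimes>\<^sub>f coord_form 2) u v)"
proof
  have "has_partial_deriv i (\<lambda>\<theta>. pareto_loglik \<theta> x) (vector [\<alpha>, \<beta>])" for i x
    using exhaust_2[of i] pareto_loglik_has_derivative_1[OF assms(1)]
      pareto_loglik_has_derivative_2[OF assms(2)]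
    unfolding has_partial_deriv_def field_differentiable_def by blast
  then show "fisher_rao_well_defined pareto_density pareto_loglik (vector [\<alpha>, \<beta>])"
    using pareto_fisher_has_bochner_integral[OF assms]
    by (auto simp: fisher_rao_well_defined_def has_bochner_integral_iff)
next
  have "fisher_matrix pareto_density pareto_loglik (vector [\<alpha>, \<beta>]) i j =
      (if i = j then if i = 1 then \<beta>\<^sup>2 / \<alpha>\<^sup>2 else 1 / \<beta>\<^sup>2 else 0)" for i j
    unfolding fisher_matrix_def
    by (rule has_bochner_integral_integral_eq[OF pareto_fisher_has_bochner_integral[OF assms]])
  then show "fisher_rao_metric pareto_density pareto_loglik (vector [\<alpha>, \<beta>]) =
      (\<lambda>u v. \<beta>\<^sup>2 / \<alpha>\<^sup>2 * (coord_form 1 \<otimes>\<^sub>f coord_form 1) u v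
           + 1 / \<beta>\<^sup>2 * (coord_form 2 \<otimes>\<^sub>f coord_form 2) u v)"
    by (simp add: fisher_rao_metric_def sum_2 fun_eq_iff)
qed

end
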